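(* Let $(A,\prec,\succ,\alpha)$ be a Hom-dendriform algebra and $\beta\colon A\to A$ be a morphism of Hom-dendriform algebras. Then $$A_\beta=(A,\ \prec_\beta\,=\beta\circ\prec,\ \succ_\beta\,=\beta\circ\succ,\ \beta\alpha)$$ is also a Hom-dendriform algebra, which is multiplicative if $A$ is. Moreover, suppose $(A',\prec',\succ',\alpha')$ is a Hom-dendriform algebra, $\beta'\colon A'\to A'$ is a morphism, and $f\colon A\to A'$ is a morphism such that $f\beta=\beta' f$. Then $f\colon A_\beta\to A'_{\beta'}$ is a morphism, where $A'_{\beta'}=(A',\beta'\circ\prec',\beta'\circ\succ',\beta'\alpha')$.
   Context: $\mathbb{K}$ is a fixed field of characteristic $0$; all maps are $\mathbb{K}$-linear. A Hom-dendriform algebra is $(A,\prec,\succ,\alpha)$ with $A$ a $\mathbb{K}$-module, linear maps $\prec,\succ\colon A\otimes A\to A$ and $\alpha\colon A\to A$ satisfying, for all $x,y,z\in A$: $(x\prec y)\prec\alpha(z)=\alpha(x)\prec(y\prec z+y\succ z)$; $(x\succ y)\prec\alpha(z)=\alpha(x)\succ(y\prec z)$; $(x\prec y+x\succ y)\succ\alpha(z)=\alpha(x)\succ(y\succ z)$. It is multiplicative if $\alpha\circ\mu=\mu\circ\alpha^{\otimes 2}$ for $\mu=\prec$ and $\mu=\succ$. A morphism $f\colon A\to A'$ of Hom-dendriform algebras is a linear map with $\prec'\circ(f\otimes f)=f\circ\prec$, $\succ'\circ(f\otimes f)=f\circ\succ$ and $f\circ\alpha=\alpha'\circ f$. *)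

theory Defs
  imports Complex_Main
begin

text \<open>Linear maps \<open>A \<otimes> A \<rightarrow> A\<close> are represented as curried
  bilinear maps \<open>A \<Rightarrow> A \<Rightarrow> A\<close>.\<close>

definition bilinear_op :: "('k::field \<Rightarrow> 'a::ab_group_add \<Rightarrow> 'a) \<Rightarrow> ('a \<Rightarrow> 'a \<Rightarrow> 'a) \<Rightarrow> bool"
  where "bilinear_op scale m \<longleftrightarrow>
    (\<forall>x. Vector_Spaces.linear scale scale (\<lambda>y. m x y)) \<and>
    (\<forall>y. Vector_Spaces.linear scale scale (\<lambda>x. m x y))"

locale hom_dendriform = vector_space scale
  for scale :: "'k::field_char_0 \<Rightarrow> 'a::ab_group_add \<Rightarrow> 'a" +
  fixes prec :: "'a \<Rightarrow> 'a \<Rightarrow> 'a" (infixl "\<prec>" 70)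
    and succ :: "'a \<Rightarrow> 'a \<Rightarrow> 'a" (infixl "\<succ>" 70)
    and \<alpha> :: "'a \<Rightarrow> 'a"
  assumes bilinear_prec: "bilinear_op scale (\<prec>)"
    and bilinear_succ: "bilinear_op scale (\<succ>)"
    and linear_twist: "Vector_Spaces.linear scale scale \<alpha>"
    and prec_prec: "(x \<prec> y) \<prec> \<alpha> z = \<alpha> x \<prec> (y \<prec> z + y \<succ> z)"
    and succ_prec: "(x \<succ> y) \<prec> \<alpha> z = \<alpha> x \<succ> (y \<prec> z)"
    and succ_succ: "(x \<prec> y + x \<succ> y) \<succ> \<alpha> z = \<alpha> x \<succ> (y \<succ> z)"

locale multiplicative_hom_dendriform = hom_dendriform +
  assumes twist_prec: "\<alpha> (x \<prec> y) = \<alpha> x \<prec> \<alpha> y"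
    and twist_succ: "\<alpha> (x \<succ> y) = \<alpha> x \<succ> \<alpha> y"

locale hom_dendriform_morphism =
  dom: hom_dendriform scale prec succ \<alpha> +
  cod: hom_dendriform scale' prec' succ' \<alpha>'
  for scale :: "'k::field_char_0 \<Rightarrow> 'a::ab_group_add \<Rightarrow> 'a"
    and prec (infixl "\<prec>" 70) and succ (infixl "\<succ>" 70) and \<alpha>
    and scale' :: "'k \<Rightarrow> 'b::ab_group_add \<Rightarrow> 'b"
    and prec' (infixl "\<prec>''" 70) and succ' (infixl "\<succ>''" 70) and \<alpha>' +
  fixes f :: "'a \<Rightarrow> 'b"
  assumes linear_map: "Vector_Spaces.linear scale scale' f"
    and map_prec: "f (x \<prec> y) = f x \<prec>' f y"
    and map_succ: "f (x \<succ> y) = f x \<succ>' f y"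
    and map_twist: "f \<circ> \<alpha> = \<alpha>' \<circ> f"

end

theory Submission
  imports Defs
begin

text \<open>Since \<beta> respects both products, an expression such as \<beta>(\<beta>(x \<prec> y)
  \<prec> \<beta>(\<alpha> z)) equals \<beta>(\<beta>((x \<prec> y) \<prec> \<alpha> z)). So each
  Hom-dendriform axiom for the twisted structure is the original axiom with \<beta> applied twice
  (\<open>hom_dendriform_twist\<close>). Multiplicativity and the compatibility of \<open>f\<close>
  follow by moving the maps past one another, using that \<beta> commutes with \<alpha> and that
  \<open>f\<close> intertwines \<beta> with \<open>\<beta>'\<close>.\<close>

lemma bilinear_op_compose:
  assumes "bilinear_op scale m" and "Vector_Spaces.linear scale scale g"
  shows "bilinear_op scale (\<lambda>x y. g (m x y))"
  using assms Vector_Spaces.linear_compose[of scale scale _ scale g]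
  unfolding bilinear_op_def comp_def by blast

lemma hom_dendriform_twist:
  assumes "hom_dendriform_morphism scale prec succ \<alpha> scale prec succ \<alpha> \<beta>"
  shows "hom_dendriform scale (\<lambda>x y. \<beta> (prec x y)) (\<lambda>x y. \<beta> (succ x y)) (\<beta> \<circ> \<alpha>)"
proof -
  interpret b: hom_dendriform_morphism scale prec succ \<alpha> scale prec succ \<alpha> \<beta>
    by (fact assms)
  \<comment> \<open>Two of the axioms contain a sum of products; additivity gathers the two twisted
    products under a single \<beta>.\<close>
  have add: "\<beta> (x + y) = \<beta> x + \<beta> y" for x y
    using b.linear_map
    by (rule module_hom.add[OF module_hom_linearI])
  show ?thesis
  proof (intro hom_dendriform.intro hom_dendriform_axioms.intro)
    show "vector_space scale"
      by (fact b.dom.vector_space_axioms)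
    show "bilinear_op scale (\<lambda>x y. \<beta> (prec x y))" "bilinear_op scale (\<lambda>x y. \<beta> (succ x y))"
      by (rule bilinear_op_compose[OF b.dom.bilinear_prec b.linear_map]
          bilinear_op_compose[OF b.dom.bilinear_succ b.linear_map])+
    show "Vector_Spaces.linear scale scale (\<beta> \<circ> \<alpha>)"
      using b.dom.linear_twist b.linear_map by (rule Vector_Spaces.linear_compose)
  \<comment> \<open>The flipped rules pull every \<beta> outwards, leaving an untwisted side of an
    axiom inside two copies of \<beta>, where the original axiom applies.\<close>
  qed (simp_all add: b.dom.prec_prec b.dom.succ_prec b.dom.succ_succ
        flip: b.map_prec b.map_succ add)
qed

lemma multiplicative_hom_dendriform_twist:
  assumes "multiplicative_hom_dendriform scale prec succ \<alpha>"
    and "hom_dendriform_morphism scale prec succ \<alpha> scale prec succ \<alpha> \<beta>"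
  shows "multiplicative_hom_dendriform scale
    (\<lambda>x y. \<beta> (prec x y)) (\<lambda>x y. \<beta> (succ x y)) (\<beta> \<circ> \<alpha>)"
proof -
  interpret a: multiplicative_hom_dendriform scale prec succ \<alpha> by (fact assms(1))
  interpret b: hom_dendriform_morphism scale prec succ \<alpha> scale prec succ \<alpha> \<beta>
    by (fact assms(2))
  \<comment> \<open>The twisting map meets the product only through \<beta>, so \<alpha> must first
    pass \<beta>; then \<beta> and \<alpha> each distribute over the product.\<close>
  have commute: "\<alpha> (\<beta> x) = \<beta> (\<alpha> x)" for x
    using b.map_twist[symmetric] by (rule comp_eq_dest)
  show ?thesis
    by (intro multiplicative_hom_dendriform.intro hom_dendriform_twist[OF assms(2)]
        multiplicative_hom_dendriform_axioms.intro)
      (simp_all add: commute a.twist_prec a.twist_succ b.map_prec b.map_succ)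
qed

lemma hom_dendriform_morphism_twist:
  assumes "hom_dendriform_morphism scale prec succ \<alpha> scale prec succ \<alpha> \<beta>"
    and "hom_dendriform_morphism scale' prec' succ' \<alpha>' scale' prec' succ' \<alpha>' \<beta>'"
    and "hom_dendriform_morphism scale prec succ \<alpha> scale' prec' succ' \<alpha>' f"
    and comm: "f \<circ> \<beta> = \<beta>' \<circ> f"
  shows "hom_dendriform_morphism
    scale (\<lambda>x y. \<beta> (prec x y)) (\<lambda>x y. \<beta> (succ x y)) (\<beta> \<circ> \<alpha>)
    scale' (\<lambda>x y. \<beta>' (prec' x y)) (\<lambda>x y. \<beta>' (succ' x y)) (\<beta>' \<circ> \<alpha>') f"
proof -
  interpret f: hom_dendriform_morphism scale prec succ \<alpha> scale' prec' succ' \<alpha>' f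
    by (fact assms(3))
  have f_\<beta>: "f (\<beta> x) = \<beta>' (f x)" for x
    using comm by (rule comp_eq_dest)
  have f_\<alpha>: "f (\<alpha> x) = \<alpha>' (f x)" for x
    using f.map_twist by (rule comp_eq_dest)
  show ?thesis
    by (intro hom_dendriform_morphism.intro hom_dendriform_twist[OF assms(1)]
        hom_dendriform_twist[OF assms(2)] hom_dendriform_morphism_axioms.intro f.linear_map)
      \<comment> \<open>In each identity \<open>f\<close> moves inwards: past \<beta>, which turns
        into \<open>\<beta>'\<close>, and then past the product or \<alpha>.\<close>
      (simp_all add: fun_eq_iff f_\<beta> f_\<alpha> f.map_prec f.map_succ)
qed

theorem theorem6p3:
  fixes scale :: "'k::field_char_0 \<Rightarrow> 'a::ab_group_add \<Rightarrow> 'a"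
    and prec succ :: "'a \<Rightarrow> 'a \<Rightarrow> 'a"
    and \<alpha> \<beta> :: "'a \<Rightarrow> 'a"
  assumes "hom_dendriform scale prec succ \<alpha>"
    and "hom_dendriform_morphism scale prec succ \<alpha> scale prec succ \<alpha> \<beta>"
  shows "hom_dendriform scale (\<lambda>x y. \<beta> (prec x y)) (\<lambda>x y. \<beta> (succ x y)) (\<beta> \<circ> \<alpha>)
    \<and> (multiplicative_hom_dendriform scale prec succ \<alpha> \<longrightarrow>
        multiplicative_hom_dendriform scale
          (\<lambda>x y. \<beta> (prec x y)) (\<lambda>x y. \<beta> (succ x y)) (\<beta> \<circ> \<alpha>))
    \<and> (\<forall>(scale' :: 'k \<Rightarrow> 'b::ab_group_add \<Rightarrow> 'b) prec' succ' \<alpha>' \<beta>' f.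
        hom_dendriform scale' prec' succ' \<alpha>' \<longrightarrow>
        hom_dendriform_morphism scale' prec' succ' \<alpha>' scale' prec' succ' \<alpha>' \<beta>' \<longrightarrow>
        hom_dendriform_morphism scale prec succ \<alpha> scale' prec' succ' \<alpha>' f \<longrightarrow>
        f \<circ> \<beta> = \<beta>' \<circ> f \<longrightarrow>
        hom_dendriform_morphism
          scale (\<lambda>x y. \<beta> (prec x y)) (\<lambda>x y. \<beta> (succ x y)) (\<beta> \<circ> \<alpha>)
          scale' (\<lambda>x y. \<beta>' (prec' x y)) (\<lambda>x y. \<beta>' (succ' x y)) (\<beta>' \<circ> \<alpha>') f)"
  \<comment> \<open>One rule serves each conjunct; the premises left over, namely multiplicativity
    or the conditions on \<open>\<beta>'\<close> and \<open>f\<close>, are antecedents of that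
    conjunct.\<close>
  by (intro conjI impI allI; (rule hom_dendriform_twist[OF assms(2)]
        | rule multiplicative_hom_dendriform_twist[OF _ assms(2)]
        | rule hom_dendriform_morphism_twist[OF assms(2)]); assumption)

end
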